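(* Let $X$ be a real Hilbert space, let $A, B\colon X\rightrightarrows X$ be maximally monotone, let $\lambda\in\, ]0,1[$ and set $T_\lambda=(1-\lambda)\mathrm{Id}+\lambda R_BR_A$. Let $\mathsf v=P_{\overline{\operatorname{ran}}(\mathrm{Id}-T)}(0)$, where $T=\tfrac12(\mathrm{Id}+R_BR_A)$, and let $Z=\{x\in X : 0\in -\mathsf v+Ax+B(x-\mathsf v)\}$. Suppose that $Z\neq\varnothing$ and that there exists $C\in\{A,B\}$ such that $C$ is uniformly monotone with a supercoercive modulus. Then there exists $\overline{x}\in X$ such that $Z=\{\overline{x}\}$. Moreover, for every $x\in X$ the following hold (convergence in norm as $n\to\infty$): (i) $J_AT_\lambda^n x\to\overline{x}$. (ii) $J_BR_AT_\lambda^n x\to\overline{x}-\mathsf v$.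
   Context: For a maximally monotone operator $C\colon X\rightrightarrows X$: $J_C=(\mathrm{Id}+C)^{-1}$ is the resolvent (single-valued with full domain) and $R_C=2J_C-\mathrm{Id}$ is the reflected resolvent. The set $\overline{\operatorname{ran}}(\mathrm{Id}-T)$ is the closure of the range of $\mathrm{Id}-T$; it is nonempty, closed and convex, and $P_D$ denotes the metric projection onto a nonempty closed convex set $D$, so $\mathsf v$ is the element of minimal norm in $\overline{\operatorname{ran}}(\mathrm{Id}-T)$. $C$ is uniformly monotone with modulus $\phi\colon \mathbb{R}_+\to[0,+\infty]$ if $\phi$ is increasing, vanishes only at $0$, and $\langle x-y,x^*-y^*\rangle\ge\phi(\|x-y\|)$ for all $(x,x^* ),(y,y^* )$ in the graph of $C$. The modulus $\phi$ is supercoercive if $\phi(t)/t\to+\infty$ as $t\to+\infty$. *)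

theory Defs
  imports "HOL-Analysis.Analysis" "HOL-Library.Set_Algebras" "HOL-Library.Extended_Real"
begin

type_synonym 'a operator = "'a \<Rightarrow> 'a set"

definition gra :: "'a operator \<Rightarrow> ('a \<times> 'a) set"
  where "gra A = {(x, u). u \<in> A x}"

definition monotone_operator :: "('a :: real_inner) operator \<Rightarrow> bool"
  where "monotone_operator A \<longleftrightarrow>
    (\<forall>(x, u) \<in> gra A. \<forall>(y, w) \<in> gra A. (x - y) \<bullet> (u - w) \<ge> 0)"

definition maximally_monotone :: "('a :: real_inner) operator \<Rightarrow> bool"
  where "maximally_monotone A \<longleftrightarrow>
    monotone_operator A \<and> (\<nexists>B. monotone_operator B \<and> gra A \<subset> gra B)"

definition inverse_operator :: "'a operator \<Rightarrow> 'a operator"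
  where "inverse_operator A = (\<lambda>u. {x. u \<in> A x})"

text \<open>
  The value of the resolvent is the unique element of the set \<open>(Id + A)\<^sup>-\<^sup>1 x\<close>, which is a
  singleton for every \<open>x\<close> in a Hilbert space when \<open>A\<close> is maximally monotone.
\<close>

definition resolvent :: "('a :: real_inner) operator \<Rightarrow> 'a \<Rightarrow> 'a"
  where "resolvent A x = the_elem (inverse_operator (\<lambda>y. {y} + A y) x)"

definition reflected_resolvent :: "('a :: real_inner) operator \<Rightarrow> 'a \<Rightarrow> 'a"
  where "reflected_resolvent A x = 2 *\<^sub>R resolvent A x - x"

text \<open>
  The library constant \<open>closest_point\<close> is restricted to Heine-Borel (finite-dimensional) spaces.
\<close>

definition metric_projection :: "('a :: real_inner) set \<Rightarrow> 'a \<Rightarrow> 'a"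
  where "metric_projection D x = (THE p. p \<in> D \<and> (\<forall>y\<in>D. dist x p \<le> dist x y))"

text \<open>
  A modulus is a function from the nonnegative reals to \<open>[0, +\<infinity>]\<close>; only the values of
  \<open>\<phi>\<close> on \<open>{0..}\<close> matter. "Increasing" means nondecreasing.
\<close>

definition uniformly_monotone_with :: "('a :: real_inner) operator \<Rightarrow> (real \<Rightarrow> ereal) \<Rightarrow> bool"
  where "uniformly_monotone_with C \<phi> \<longleftrightarrow>
    (\<forall>t\<ge>0. 0 \<le> \<phi> t) \<and> mono_on {0..} \<phi> \<and> (\<forall>t\<ge>0. \<phi> t = 0 \<longleftrightarrow> t = 0) \<and>
    (\<forall>(x, u) \<in> gra C. \<forall>(y, w) \<in> gra C. ereal ((x - y) \<bullet> (u - w)) \<ge> \<phi> (norm (x - y)))"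

definition supercoercive :: "(real \<Rightarrow> ereal) \<Rightarrow> bool"
  where "supercoercive \<phi> \<longleftrightarrow> ((\<lambda>t. \<phi> t / ereal t) \<longlongrightarrow> \<infinity>) at_top"

end

theory Submission
  imports Defs
begin

text \<open>
  Write \<open>M = Id - T\<close>, \<open>a = J_A\<close> and \<open>b = J_B R_A\<close>, so that \<open>M = a - b\<close> and \<open>T\<^sub>l = Id - 2 lam M\<close>. With
  \<open>a* = Id - a\<close> and \<open>b* = R_A - b\<close>, differences between two points satisfy
  \<open>\<langle>\<Delta>T, \<Delta>M\<rangle> = \<langle>\<Delta>a, \<Delta>a*\<rangle> + \<langle>\<Delta>b, \<Delta>b*\<rangle>\<close>, a sum of two nonnegative terms. If \<open>M y = v\<close>, then the
  variational inequality for \<open>v\<close> yields \<open>M (y - t v) = v\<close> for all \<open>t \<ge> 0\<close>, so \<open>y\<^sub>n = y - 2 lam n v\<close> is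
  an orbit of \<open>T\<^sub>l\<close>. Along it, the squared distance to any other orbit decreases by exactly
  \<open>4 lam (1 - lam) |\<Delta>M|\<^sup>2 + 4 lam \<langle>\<Delta>T, \<Delta>M\<rangle>\<close>. Hence \<open>\<Delta>M\<close>, \<open>\<langle>\<Delta>a, \<Delta>a*\<rangle>\<close> and \<open>\<langle>\<Delta>b, \<Delta>b*\<rangle>\<close> all tend to
  \<open>0\<close>, and uniform monotonicity turns this into \<open>\<Delta>a \<longlonglongrightarrow> 0\<close> and \<open>\<Delta>b \<longlonglongrightarrow> 0\<close>.

  That resolvents are everywhere defined (Minty's theorem) is obtained by minimising the Fitzpatrick
  function plus half the squared norm: this is strongly convex, so minimising sequences are Cauchy
  and no weak compactness is needed.
\<close>

section \<open>Strongly convex minimisation\<close>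

lemma parallelogram_midpoint:
  fixes p q :: "'a::real_inner"
  shows "(norm ((1/2) *\<^sub>R p + (1/2) *\<^sub>R q))\<^sup>2 = (norm p)\<^sup>2 / 2 + (norm q)\<^sup>2 / 2 - (norm (p - q))\<^sup>2 / 4"
  by (simp add: power2_norm_eq_inner inner_add_left inner_add_right inner_diff_left
      inner_diff_right inner_commute field_simps)

text \<open>\<open>E\<close> stands for the epigraph of a convex function. By the parallelogram
  identity, two nearly optimal points with distant first components would have a midpoint below the
  infimum.\<close>

lemma epigraph_minimizer_exists:
  fixes E :: "('a::{real_inner,complete_space} \<times> real) set"
  assumes "convex E" "closed E" "E \<noteq> {}"
    and bdd: "\<And>p r. (p, r) \<in> E \<Longrightarrow> c \<le> r + (norm p)\<^sup>2 / 2"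
  obtains p0 r0 where "(p0, r0) \<in> E"
    and "\<And>p r. (p, r) \<in> E \<Longrightarrow> r0 + (norm p0)\<^sup>2 / 2 \<le> r + (norm p)\<^sup>2 / 2"
proof -
  define f where "f = (\<lambda>(p::'a, r). r + (norm p)\<^sup>2 / 2)"
  define m where "m = Inf (f ` E)"
  have bdd': "bdd_below (f ` E)"
    using bdd by (intro bdd_belowI[of _ c]) (auto simp: f_def)
  have m_le: "m \<le> f e" if "e \<in> E" for e
    unfolding m_def using bdd' that by (simp add: cINF_lower)
  have "\<exists>e\<in>E. f e < m + inverse (Suc n)" for n
    using cINF_less_iff[OF assms(3) bdd', of "m + inverse (Suc n)"] unfolding m_def by simp
  then obtain e where e: "\<And>n. e n \<in> E" "\<And>n. f (e n) < m + inverse (Suc n)"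
    by metis
  define P R where "P = (\<lambda>n. fst (e n))" and "R = (\<lambda>n. snd (e n))"
  have eq: "e n = (P n, R n)" for n
    by (simp add: P_def R_def)
  have gap: "(norm (P i - P j))\<^sup>2 \<le> 4 * (inverse (Suc i) + inverse (Suc j))" for i j
  proof -
    have "(1/2) *\<^sub>R e i + (1/2) *\<^sub>R e j \<in> E"
      using \<open>convex E\<close> e(1) by (intro convexD) auto
    from m_le[OF this] have "m \<le> (R i + R j) / 2 + (norm ((1/2) *\<^sub>R P i + (1/2) *\<^sub>R P j))\<^sup>2 / 2"
      by (simp add: f_def eq add_divide_distrib)
    then have "(norm (P i - P j))\<^sup>2 / 4 \<le> f (e i) + f (e j) - 2 * m"
      unfolding parallelogram_midpoint by (simp add: f_def eq field_simps)
    also have "\<dots> \<le> inverse (Suc i) + inverse (Suc j)"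
      using e(2)[of i] e(2)[of j] by simp
    finally show ?thesis by simp
  qed
  have "Cauchy P"
  proof (rule metric_CauchyI)
    fix \<epsilon> :: real assume "\<epsilon> > 0"
    then obtain N where N: "inverse (real (Suc N)) < \<epsilon>\<^sup>2 / 8"
      using reals_Archimedean[of "\<epsilon>\<^sup>2 / 8"] by auto
    have "dist (P i) (P j) < \<epsilon>" if "i \<ge> N" "j \<ge> N" for i j
    proof -
      have "(norm (P i - P j))\<^sup>2 \<le> 4 * (inverse (Suc i) + inverse (Suc j))"
        by (rule gap)
      also have "\<dots> \<le> 4 * (inverse (Suc N) + inverse (Suc N))"
        using that by (intro mult_left_mono add_mono le_imp_inverse_le) auto
      also have "\<dots> < \<epsilon>\<^sup>2"
        using N by simp
      finally have "(norm (P i - P j))\<^sup>2 < \<epsilon>\<^sup>2" .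
      then show ?thesis
        using \<open>\<epsilon> > 0\<close> by (simp add: dist_norm power_less_imp_less_base)
    qed
    then show "\<exists>N. \<forall>i\<ge>N. \<forall>j\<ge>N. dist (P i) (P j) < \<epsilon>" by blast
  qed
  then obtain p0 where P: "P \<longlonglongrightarrow> p0"
    using Cauchy_convergent convergent_def by blast
  have "(\<lambda>n. f (e n)) \<longlonglongrightarrow> m"
  proof (rule real_tendsto_sandwich[of "\<lambda>_. m" _ _ "\<lambda>n. m + inverse (Suc n)"])
    show "(\<lambda>n. m + inverse (real (Suc n))) \<longlonglongrightarrow> m"
      using tendsto_add[OF tendsto_const LIMSEQ_inverse_real_of_nat, of m] by simp
  qed (use e m_le in \<open>auto intro!: always_eventually less_imp_le\<close>)
  \<comment> \<open>The heights \<open>R\<close> have no Cauchy estimate of their own; they converge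
    as objective value minus quadratic term.\<close>
  then have "(\<lambda>n. f (e n) - (norm (P n))\<^sup>2 / 2) \<longlonglongrightarrow> m - (norm p0)\<^sup>2 / 2"
    by (intro tendsto_intros P) simp_all
  then have "R \<longlonglongrightarrow> m - (norm p0)\<^sup>2 / 2"
    by (simp add: f_def eq)
  from tendsto_Pair[OF P this] have "e \<longlonglongrightarrow> (p0, m - (norm p0)\<^sup>2 / 2)"
    by (simp add: eq[symmetric])
  then have "(p0, m - (norm p0)\<^sup>2 / 2) \<in> E"
    using \<open>closed E\<close> e(1) closed_sequentially by blast
  moreover have "m \<le> r + (norm p)\<^sup>2 / 2" if "(p, r) \<in> E" for p r
    using m_le[OF that] by (simp add: f_def)
  ultimately show ?thesis
    by (intro that) auto
qed

text \<open>First-order optimality: move a fraction \<open>t\<close> from the minimiser towards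
  \<open>(p, r)\<close> inside \<open>E\<close>, divide by \<open>t\<close> and let \<open>t\<close>
  tend to 0.\<close>

lemma epigraph_minimizer:
  fixes E :: "('a::{real_inner,complete_space} \<times> real) set"
  assumes "convex E" "closed E" "E \<noteq> {}"
    and "\<And>p r. (p, r) \<in> E \<Longrightarrow> c \<le> r + (norm p)\<^sup>2 / 2"
  obtains p0 r0 where "(p0, r0) \<in> E"
    and "\<And>p r. (p, r) \<in> E \<Longrightarrow> r0 + p0 \<bullet> p0 \<le> r + p0 \<bullet> p"
proof -
  obtain p0 r0 where E0: "(p0, r0) \<in> E"
    and min: "\<And>p r. (p, r) \<in> E \<Longrightarrow> r0 + (norm p0)\<^sup>2 / 2 \<le> r + (norm p)\<^sup>2 / 2"
    using epigraph_minimizer_exists[OF assms] by metis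
  have "r0 + p0 \<bullet> p0 \<le> r + p0 \<bullet> p" if "(p, r) \<in> E" for p r
  proof -
    define g where "g = r - r0 + p0 \<bullet> (p - p0)"
    have "0 \<le> g + t * ((norm (p - p0))\<^sup>2 / 2)" if t: "0 < t" "t < 1" for t
    proof -
      have "(1 - t) *\<^sub>R (p0, r0) + t *\<^sub>R (p, r) \<in> E"
        using \<open>convex E\<close> E0 \<open>(p, r) \<in> E\<close> t by (intro convexD) auto
      moreover have "(1 - t) *\<^sub>R (p0, r0) + t *\<^sub>R (p, r) = (p0 + t *\<^sub>R (p - p0), r0 + t * (r - r0))"
        by (simp add: algebra_simps)
      ultimately have "r0 + (norm p0)\<^sup>2 / 2 \<le> r0 + t * (r - r0) + (norm (p0 + t *\<^sub>R (p - p0)))\<^sup>2 / 2"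
        using min by metis
      also have "(norm (p0 + t *\<^sub>R (p - p0)))\<^sup>2
          = (norm p0)\<^sup>2 + 2 * t * (p0 \<bullet> (p - p0)) + t * t * (norm (p - p0))\<^sup>2"
        by (simp add: power2_norm_eq_inner inner_add_left inner_add_right inner_commute algebra_simps)
      finally have "0 \<le> t * (g + t * ((norm (p - p0))\<^sup>2 / 2))"
        by (simp add: g_def field_simps)
      then show ?thesis
        using t by (simp add: zero_le_mult_iff)
    qed
    then have "\<forall>\<^sub>F t in at_right 0. 0 \<le> g + t * ((norm (p - p0))\<^sup>2 / 2)"
      unfolding eventually_at_right_field by (intro exI[of _ 1]) auto
    moreover have "((\<lambda>t. g + t * ((norm (p - p0))\<^sup>2 / 2)) \<longlongrightarrow> g + 0 * ((norm (p - p0))\<^sup>2 / 2)) (at_right 0)"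
      by (intro tendsto_intros)
    ultimately have "0 \<le> g"
      using tendsto_lowerbound[of _ _ "at_right (0::real)" 0] by fastforce
    then show ?thesis
      by (simp add: g_def inner_diff_right)
  qed
  then show ?thesis
    using E0 that by blast
qed

lemma metric_projection:
  fixes D :: "'a::{real_inner,complete_space} set"
  assumes "convex D" "closed D" "D \<noteq> {}"
  shows "metric_projection D x \<in> D"
    and "y \<in> D \<Longrightarrow> (x - metric_projection D x) \<bullet> (y - metric_projection D x) \<le> 0"
proof -
  \<comment> \<open>The translate of \<open>D\<close> by \<open>- x\<close>, placed at height 0: its
    element of least norm is the projection minus \<open>x\<close>, and first-order optimality
    becomes the variational inequality.\<close>
  define E where "E = {(p, r::real). p + x \<in> D \<and> r = 0}"
  have "convex E"
  proof (rule convexI)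
    fix e f and s t :: real
    assume *: "e \<in> E" "f \<in> E" "0 \<le> s" "0 \<le> t" "s + t = 1"
    have "s *\<^sub>R (fst e + x) + t *\<^sub>R (fst f + x) \<in> D"
      using * by (intro convexD[OF \<open>convex D\<close>]) (auto simp: E_def)
    also have "s *\<^sub>R (fst e + x) + t *\<^sub>R (fst f + x) = s *\<^sub>R fst e + t *\<^sub>R fst f + (s + t) *\<^sub>R x"
      by (simp add: algebra_simps)
    finally show "s *\<^sub>R e + t *\<^sub>R f \<in> E"
      using * by (auto simp: E_def)
  qed
  moreover have "closed E"
  proof -
    have "E = (\<lambda>e. fst e + x) -` D \<inter> {e. snd e = 0}"
      by (auto simp: E_def)
    then show ?thesis
      by (auto intro!: closed_Int closed_vimage closed_Collect_eq continuous_intros \<open>closed D\<close>)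
  qed
  moreover obtain d where "d \<in> D" using \<open>D \<noteq> {}\<close> by blast
  then have "(d - x, 0) \<in> E" by (simp add: E_def)
  moreover have "0 \<le> r + (norm p)\<^sup>2 / 2" if "(p, r) \<in> E" for p r
    using that by (simp add: E_def)
  ultimately obtain p0 r0 where "(p0, r0) \<in> E"
    and min: "\<And>p r. (p, r) \<in> E \<Longrightarrow> r0 + p0 \<bullet> p0 \<le> r + p0 \<bullet> p"
    using epigraph_minimizer[of E 0] by blast
  define q where "q = p0 + x"
  have q: "q \<in> D" and [simp]: "r0 = 0"
    using \<open>(p0, r0) \<in> E\<close> by (auto simp: E_def q_def)
  have vi: "(x - q) \<bullet> (y - q) \<le> 0" if "y \<in> D" for y
    using min[of "y - x" 0] that by (simp add: E_def q_def algebra_simps inner_diff_right)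
  \<comment> \<open>This yields both minimality of \<open>q\<close> and its uniqueness, which the
    \<open>THE\<close> in \<open>metric_projection\<close> requires.\<close>
  have pyth: "(dist x q)\<^sup>2 + (dist q y)\<^sup>2 \<le> (dist x y)\<^sup>2" if "y \<in> D" for y
    using vi[OF that]
    by (simp add: dist_norm power2_norm_eq_inner inner_diff_left inner_diff_right inner_commute)
  have "metric_projection D x = q"
    unfolding metric_projection_def
  proof (rule the_equality)
    have "dist x q \<le> dist x y" if "y \<in> D" for y
    proof (rule power2_le_imp_le)
      show "(dist x q)\<^sup>2 \<le> (dist x y)\<^sup>2"
        using pyth[OF that] zero_le_power2[of "dist q y"] by linarith
    qed simp
    then show "q \<in> D \<and> (\<forall>y\<in>D. dist x q \<le> dist x y)"
      using q by blast
    fix p assume p: "p \<in> D \<and> (\<forall>y\<in>D. dist x p \<le> dist x y)"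
    then have "(dist x p)\<^sup>2 \<le> (dist x q)\<^sup>2"
      using q by (simp add: power_mono)
    then have "(dist q p)\<^sup>2 \<le> 0"
      using pyth[of p] p by linarith
    then show "p = q" by simp
  qed
  then show "metric_projection D x \<in> D"
    and "y \<in> D \<Longrightarrow> (x - metric_projection D x) \<bullet> (y - metric_projection D x) \<le> 0"
    using q vi by simp_all
qed

section \<open>Resolvents of maximally monotone operators\<close>

text \<open>The set \<open>E\<close> in the proof is the epigraph of the Fitzpatrick function of \<open>G\<close>.\<close>

lemma minty_zero:
  fixes G :: "('a::{real_inner,complete_space} \<times> 'a) set"
  assumes mono: "\<And>x u y w. (x, u) \<in> G \<Longrightarrow> (y, w) \<in> G \<Longrightarrow> 0 \<le> (x - y) \<bullet> (u - w)"
    and max: "\<And>x u. (\<And>y w. (y, w) \<in> G \<Longrightarrow> 0 \<le> (x - y) \<bullet> (u - w)) \<Longrightarrow> (x, u) \<in> G"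
  shows "\<exists>x. (x, - x) \<in> G"
proof -
  define E where "E = (\<Inter>(y, w)\<in>G. {e. (w, y) \<bullet> fst e - y \<bullet> w \<le> snd e})"
  have E_iff: "((x, u), r) \<in> E \<longleftrightarrow> (\<forall>(y, w)\<in>G. x \<bullet> w + y \<bullet> u - y \<bullet> w \<le> r)" for x u r
    by (auto simp: E_def inner_commute)
  have "convex E"
    unfolding E_def
  proof (intro convex_INT, clarify)
    fix y w
    have "{e. (w, y) \<bullet> fst e - y \<bullet> w \<le> snd e} = {e. ((w, y), -1 :: real) \<bullet> e \<le> y \<bullet> w}"
      by (auto simp: inner_prod_def)
    then show "convex {e. (w, y) \<bullet> fst e - y \<bullet> w \<le> snd e}"
      by (simp only: convex_halfspace_le)
  qed
  moreover have "closed E"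
    unfolding E_def by (auto intro!: closed_INT closed_Collect_le continuous_intros)
  moreover have "E \<noteq> {}"
  proof -
    \<comment> \<open>Were \<open>G\<close> empty, \<open>max\<close> would vacuously put
      \<open>(0, 0)\<close> into it.\<close>
    obtain x u where xu: "(x, u) \<in> G"
      using max[of 0 0] by fast
    have "x \<bullet> w + y \<bullet> u - y \<bullet> w \<le> x \<bullet> u" if "(y, w) \<in> G" for y w
      using mono[OF xu that] by (simp add: inner_diff_left inner_diff_right)
    then have "((x, u), x \<bullet> u) \<in> E"
      by (auto simp: E_iff)
    then show ?thesis by blast
  qed
  \<comment> \<open>The Fitzpatrick function dominates the duality product: on \<open>G\<close>,
    test with the pair itself; off \<open>G\<close>, test with a pair violating monotonicity,
    supplied by maximality.\<close>
  moreover have fitz: "x \<bullet> u \<le> r" if "((x, u), r) \<in> E" for x u r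
  proof (cases "(x, u) \<in> G")
    case True
    then show ?thesis using that by (force simp: E_iff)
  next
    case False
    then obtain y w where "(y, w) \<in> G" "(x - y) \<bullet> (u - w) < 0"
      using max by (meson not_le)
    then show ?thesis
      using that by (force simp: E_iff inner_diff_left inner_diff_right)
  qed
  have "0 \<le> r + (norm p)\<^sup>2 / 2" if "(p, r) \<in> E" for p r
  proof -
    obtain x u where p: "p = (x, u)" by fastforce
    have "0 \<le> (x + u) \<bullet> (x + u)" by simp
    also have "\<dots> = 2 * (x \<bullet> u + (norm p)\<^sup>2 / 2)"
      by (simp add: p norm_Pair power2_norm_eq_inner inner_add_left inner_add_right inner_commute)
    finally show ?thesis
      using fitz that by (fastforce simp: p)
  qed
  ultimately obtain p0 r0 where E0: "(p0, r0) \<in> E"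
    and min: "\<And>p r. (p, r) \<in> E \<Longrightarrow> r0 + p0 \<bullet> p0 \<le> r + p0 \<bullet> p"
    using epigraph_minimizer[of E 0] by blast
  obtain x u where p0: "p0 = (x, u)" by fastforce
  have r0: "x \<bullet> u \<le> r0"
    using fitz E0 p0 by blast
  \<comment> \<open>Test optimality at \<open>((y, w), y \<bullet> w)\<close>, which lies in
    \<open>E\<close> by monotonicity, and add \<open>x \<bullet> u\<close> to both sides. So
    \<open>(- u, - x)\<close> is monotonically related to \<open>G\<close> and lies in it; taking it
    as \<open>(y, w)\<close> then forces \<open>u = - x\<close>.\<close>
  have key: "(x + u) \<bullet> (x + u) \<le> (- u - y) \<bullet> (- x - w)" if yw: "(y, w) \<in> G" for y w
  proof -
    have "y \<bullet> w' + y' \<bullet> w - y' \<bullet> w' \<le> y \<bullet> w" if "(y', w') \<in> G" for y' w'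
      using mono[OF yw that] by (simp add: inner_diff_left inner_diff_right)
    then have "((y, w), y \<bullet> w) \<in> E"
      by (auto simp: E_iff)
    from min[OF this] show ?thesis
      using r0 by (simp add: p0 inner_add_left inner_add_right inner_diff_left inner_diff_right inner_commute)
  qed
  have G: "(- u, - x) \<in> G"
    using key by (intro max) (smt (verit) inner_ge_zero)
  from key[OF this] have "(x + u) \<bullet> (x + u) \<le> 0" by simp
  then have "x + u = 0"
    by (meson inner_eq_zero_iff inner_ge_zero order_antisym)
  then show ?thesis
    using G by (metis add.inverse_inverse add_eq_0_iff)
qed

lemma maximally_monotone_mono:
  assumes "maximally_monotone A" "u \<in> A x" "w \<in> A y"
  shows "0 \<le> (x - y) \<bullet> (u - w)"
  using assms by (force simp: maximally_monotone_def monotone_operator_def gra_def)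

text \<open>Otherwise adjoining \<open>(x, u)\<close> to the graph would give a strictly larger
  monotone operator.\<close>

lemma maximally_monotone_memI:
  assumes max: "maximally_monotone A" and rel: "\<And>y w. w \<in> A y \<Longrightarrow> 0 \<le> (x - y) \<bullet> (u - w)"
  shows "u \<in> A x"
proof (rule ccontr)
  assume "u \<notin> A x"
  define B where "B = A(x := insert u (A x))"
  have gB: "gra B = insert (x, u) (gra A)"
    by (auto simp: gra_def B_def split: if_splits)
  have rel': "0 \<le> (y - x) \<bullet> (w - u)" if "w \<in> A y" for y w
    using rel[OF that] by (metis inner_minus_left inner_minus_right minus_diff_eq)
  have "monotone_operator B"
    unfolding monotone_operator_def gB
    using maximally_monotone_mono[OF max] rel rel' by (auto simp: gra_def)
  moreover have "gra A \<subset> gra B"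
    using \<open>u \<notin> A x\<close> by (auto simp: gB) (auto simp: gra_def)
  ultimately show False
    using max by (auto simp: maximally_monotone_def)
qed

text \<open>Translating the values of \<open>A\<close> by \<open>- z\<close> preserves maximal
  monotonicity and reduces the claim to \<open>minty_zero\<close>.\<close>

lemma minty:
  fixes A :: "'a::{real_inner,complete_space} operator"
  assumes "maximally_monotone A"
  shows "\<exists>x. z - x \<in> A x"
proof -
  have "\<exists>x. (x, - x) \<in> {(x, u). u + z \<in> A x}"
  proof (rule minty_zero)
    fix x u y w assume "(x, u) \<in> {(x, u). u + z \<in> A x}" "(y, w) \<in> {(x, u). u + z \<in> A x}"
    then show "0 \<le> (x - y) \<bullet> (u - w)"
      using maximally_monotone_mono[OF assms, of "u + z" x "w + z" y] by simp
  next
    fix x u assume *: "\<And>y w. (y, w) \<in> {(x, u). u + z \<in> A x} \<Longrightarrow> 0 \<le> (x - y) \<bullet> (u - w)"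
    have "0 \<le> (x - y) \<bullet> (u + z - w)" if "w \<in> A y" for y w
      using *[of y "w - z"] that by (simp add: algebra_simps)
    then show "(x, u) \<in> {(x, u). u + z \<in> A x}"
      using maximally_monotone_memI[OF assms] by blast
  qed
  then show ?thesis by (simp add: add.commute)
qed

lemma resolvent_eqI:
  assumes max: "maximally_monotone A" and y: "x - y \<in> A y"
  shows "resolvent A x = y"
proof -
  have "z = y" if z: "x - z \<in> A z" for z
  proof -
    have "(z - y) \<bullet> (z - y) \<le> 0"
      using maximally_monotone_mono[OF max z y]
      by (simp add: inner_diff_left inner_diff_right inner_commute)
    then have "z - y = 0"
      by (meson inner_eq_zero_iff inner_ge_zero order_antisym)
    then show ?thesis by simp
  qed
  moreover have "inverse_operator (\<lambda>y. {y} + A y) x = {z. x - z \<in> A z}"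
    by (auto simp: inverse_operator_def set_plus_def) (metis add.commute diff_add_cancel)
  ultimately have "inverse_operator (\<lambda>y. {y} + A y) x = {y}"
    using y by blast
  then show ?thesis
    by (simp add: resolvent_def)
qed

lemma resolvent_mem:
  fixes A :: "'a::{real_inner,complete_space} operator"
  assumes "maximally_monotone A"
  shows "x - resolvent A x \<in> A (resolvent A x)"
  using minty[OF assms, of x] resolvent_eqI[OF assms, of x] by metis

section \<open>The range of the displacement operator\<close>

lemma nonexpansive_displacement_monotone:
  fixes T :: "'a::real_inner \<Rightarrow> 'a"
  assumes "norm (T x - T y) \<le> norm (x - y)"
  shows "0 \<le> (x - y) \<bullet> ((x - T x) - (y - T y))"
proof -
  have "(x - y) \<bullet> (T x - T y) \<le> norm (x - y) * norm (T x - T y)"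
    by (rule norm_cauchy_schwarz)
  also have "\<dots> \<le> norm (x - y) * norm (x - y)"
    using assms by (intro mult_left_mono) auto
  also have "\<dots> = (x - y) \<bullet> (x - y)"
    by (metis power2_eq_square power2_norm_eq_inner)
  finally show ?thesis
    by (simp add: inner_diff_right algebra_simps)
qed

text \<open>The equation reads \<open>(1 + e) *\<^sub>R x = T x + u\<close>; dividing by
  \<open>1 + e\<close> gives a fixed-point problem for a contraction.\<close>

lemma nonexpansive_displacement_perturbed_surj:
  fixes T :: "'a::{real_inner,complete_space} \<Rightarrow> 'a"
  assumes ne: "\<And>x y. norm (T x - T y) \<le> norm (x - y)" and "0 < e"
  shows "\<exists>x. e *\<^sub>R x + (x - T x) = u"
proof -
  define f where "f x = inverse (1 + e) *\<^sub>R (T x + u)" for x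
  have "dist (f x) (f y) \<le> inverse (1 + e) * dist x y" for x y
  proof -
    have "dist (f x) (f y) = norm (inverse (1 + e) *\<^sub>R (T x - T y))"
      by (simp add: f_def dist_norm algebra_simps)
    also have "\<dots> \<le> inverse (1 + e) * dist x y"
      using ne[of x y] \<open>0 < e\<close> by (simp add: dist_norm mult_left_mono)
    finally show ?thesis .
  qed
  moreover have "0 \<le> inverse (1 + e)" "inverse (1 + e) < 1"
    using \<open>0 < e\<close> by (simp_all add: inverse_less_1_iff)
  ultimately have "\<exists>!x. f x = x"
    by (intro banach_fix_type) auto
  then obtain x where "f x = x" by blast
  then have "(1 + e) *\<^sub>R x = (1 + e) *\<^sub>R f x" by simp
  also have "\<dots> = T x + u"
    using \<open>0 < e\<close> by (simp add: f_def)
  finally show ?thesis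
    by (intro exI[of _ x]) (simp add: algebra_simps)
qed

text \<open>
  A convex combination \<open>u\<close> of two values of \<open>M = Id - T\<close> is approximated by \<open>M x\<^sub>e = u - e x\<^sub>e\<close>:
  averaging the monotonicity inequalities at the two points cancels the term linear in \<open>x\<^sub>e\<close>, which
  bounds \<open>e |x\<^sub>e|\<^sup>2\<close> uniformly up to \<open>e |x\<^sub>e|\<close>.
\<close>

lemma nonexpansive_displacement_combination:
  fixes T :: "'a::{real_inner,complete_space} \<Rightarrow> 'a"
  assumes ne: "\<And>x y. norm (T x - T y) \<le> norm (x - y)"
    and st: "0 \<le> s" "0 \<le> t" "s + t = (1::real)"
  shows "s *\<^sub>R (y - T y) + t *\<^sub>R (z - T z) \<in> closure (range (\<lambda>x. x - T x))"
proof -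
  define M where "M = (\<lambda>x. x - T x)"
  define u where "u = s *\<^sub>R M y + t *\<^sub>R M z"
  define h where "h = s *\<^sub>R y + t *\<^sub>R z"
  \<comment> \<open>What remains, independently of \<open>x\<close> and \<open>e\<close>, when
    \<open>M x = u - e *\<^sub>R x\<close> is substituted into the averaged monotonicity
    inequality.\<close>
  define c where "c = s * (y \<bullet> M y) + t * (z \<bullet> M z) - h \<bullet> u"
  have approx: "\<exists>x. e * (norm x)\<^sup>2 \<le> e * (x \<bullet> h) + c \<and> M x = u - e *\<^sub>R x" if e: "0 < e" for e
  proof -
    obtain x where x: "e *\<^sub>R x + M x = u"
      using nonexpansive_displacement_perturbed_surj[OF ne e] unfolding M_def by blast
    then have Mx: "M x = u - e *\<^sub>R x"
      by (metis add_diff_cancel_left')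
    have "0 \<le> s * ((x - y) \<bullet> (M x - M y)) + t * ((x - z) \<bullet> (M x - M z))"
      using nonexpansive_displacement_monotone[of T, OF ne] st unfolding M_def
      by (intro add_nonneg_nonneg mult_nonneg_nonneg) auto
    also have "\<dots> = (s + t) * (x \<bullet> M x) - x \<bullet> u - h \<bullet> M x + s * (y \<bullet> M y) + t * (z \<bullet> M z)"
      by (simp add: u_def h_def inner_add_left inner_add_right inner_diff_left inner_diff_right algebra_simps)
    also have "\<dots> = e * (x \<bullet> h) + c - e * (norm x)\<^sup>2"
      unfolding Mx st(3)
      by (simp add: c_def inner_diff_right power2_norm_eq_inner algebra_simps inner_commute)
    finally show ?thesis using Mx by auto
  qed
  have "\<exists>w\<in>range M. dist w u < d" if d: "0 < d" for d
  proof -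
    define k where "k = d * norm h + \<bar>c\<bar>"
    \<comment> \<open>Makes the bound \<open>e * (p * norm h + \<bar>c\<bar>)\<close> on
      \<open>p\<^sup>2\<close>, derived below, smaller than \<open>d\<^sup>2\<close> at
      \<open>p = d\<close>. The bound is affine in \<open>p\<close>, so it then fails for every
      \<open>p \<ge> d\<close>. The \<open>+ 1\<close> keeps the denominator positive.\<close>
    define e where "e = d\<^sup>2 / (2 * (k + 1))"
    have "0 \<le> k"
      using d by (simp add: k_def)
    then have e: "0 < e" and "e * (k + 1) = d\<^sup>2 / 2"
      using d by (simp_all add: e_def add_nonneg_pos field_simps)
    then have "e * k < d\<^sup>2"
      using d by (simp add: distrib_left) (smt (verit) zero_less_power)
    then have small: "e * (d * norm h + \<bar>c\<bar>) < d\<^sup>2"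
      by (simp add: k_def)
    obtain x where x: "e * (norm x)\<^sup>2 \<le> e * (x \<bullet> h) + c" "M x = u - e *\<^sub>R x"
      using approx[OF e] by blast
    define p where "p = e * norm x"
    have "p\<^sup>2 = e * (e * (norm x)\<^sup>2)"
      by (simp add: p_def power2_eq_square)
    also have "\<dots> \<le> e * (e * (norm x * norm h) + \<bar>c\<bar>)"
      using x(1) e norm_cauchy_schwarz[of x h]
      by (intro mult_left_mono) (smt (verit) mult_left_mono, simp)
    also have "\<dots> = e * (p * norm h + \<bar>c\<bar>)"
      by (simp add: p_def)
    finally have p: "p\<^sup>2 \<le> e * (p * norm h + \<bar>c\<bar>)" .
    have "p < d"
    proof (rule ccontr)
      assume "\<not> p < d"
      then have pd: "d \<le> p" by simp
      have "d * p\<^sup>2 \<le> d * (e * (p * norm h + \<bar>c\<bar>))"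
        using p d by simp
      also have "\<dots> \<le> p * (e * (d * norm h + \<bar>c\<bar>))"
        using pd d e by (simp add: algebra_simps mult_right_mono mult_left_mono)
      also have "\<dots> < p * d\<^sup>2"
        using small pd d by simp
      also have "\<dots> \<le> d * p\<^sup>2"
        using pd d by (simp add: power2_eq_square)
      finally show False by simp
    qed
    moreover have "dist (M x) u = p"
      using e by (simp add: x(2) dist_norm p_def)
    ultimately show ?thesis by auto
  qed
  then show ?thesis
    unfolding closure_approachable u_def M_def by blast
qed

text \<open>Combinations of two range points are already known to lie in the closure. Closedness
  extends this to limits, one argument at a time.\<close>

lemma convex_closure_nonexpansive_displacement:
  fixes T :: "'a::{real_inner,complete_space} \<Rightarrow> 'a"
  assumes ne: "\<And>x y. norm (T x - T y) \<le> norm (x - y)"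
  shows "convex (closure (range (\<lambda>x. x - T x)))" (is "convex (closure ?R)")
proof (rule convexI)
  fix p q and s t :: real
  assume p: "p \<in> closure ?R" and q: "q \<in> closure ?R" and st: "0 \<le> s" "0 \<le> t" "s + t = 1"
  have 1: "closure ?R \<subseteq> {q. s *\<^sub>R p + t *\<^sub>R q \<in> closure ?R}" if "p \<in> ?R" for p
  proof (rule closure_minimal)
    show "?R \<subseteq> {q. s *\<^sub>R p + t *\<^sub>R q \<in> closure ?R}"
      using nonexpansive_displacement_combination[OF ne st] that by auto
    have "closed ((\<lambda>q. s *\<^sub>R p + t *\<^sub>R q) -` closure ?R)"
      by (intro closed_vimage continuous_intros) simp
    then show "closed {q. s *\<^sub>R p + t *\<^sub>R q \<in> closure ?R}"
      by (simp add: vimage_def)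
  qed
  have "closure ?R \<subseteq> {p. s *\<^sub>R p + t *\<^sub>R q \<in> closure ?R}"
  proof (rule closure_minimal)
    show "?R \<subseteq> {p. s *\<^sub>R p + t *\<^sub>R q \<in> closure ?R}"
      using 1 q by blast
    have "closed ((\<lambda>p. s *\<^sub>R p + t *\<^sub>R q) -` closure ?R)"
      by (intro closed_vimage continuous_intros) simp
    then show "closed {p. s *\<^sub>R p + t *\<^sub>R q \<in> closure ?R}"
      by (simp add: vimage_def)
  qed
  then show "s *\<^sub>R p + t *\<^sub>R q \<in> closure ?R"
    using p by blast
qed

section \<open>Convergence of the shadow sequences\<close>

text \<open>Whenever \<open>norm (x n - y n) \<ge> d\<close>, the inner product is at least
  \<open>\<phi> d > 0\<close>, which is impossible for large \<open>n\<close>.\<close>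

lemma uniformly_monotone_with_tendsto:
  assumes "uniformly_monotone_with C \<phi>"
    and "\<And>n. u n \<in> C (x n)" "\<And>n. w n \<in> C (y n)"
    and lim: "(\<lambda>n. (x n - y n) \<bullet> (u n - w n)) \<longlonglongrightarrow> 0"
  shows "(\<lambda>n. x n - y n) \<longlonglongrightarrow> 0"
proof (rule LIMSEQ_I)
  fix d :: real assume d: "0 < d"
  have um: "\<phi> (norm (x n - y n)) \<le> ereal ((x n - y n) \<bullet> (u n - w n))" for n
    using assms(1-3) by (fastforce simp: uniformly_monotone_with_def gra_def)
  have "0 < \<phi> d"
    using assms(1) d by (auto simp: uniformly_monotone_with_def less_le)
  moreover have "(\<lambda>n. ereal ((x n - y n) \<bullet> (u n - w n))) \<longlonglongrightarrow> ereal 0"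
    using lim by simp
  ultimately have "\<forall>\<^sub>F n in sequentially. ereal ((x n - y n) \<bullet> (u n - w n)) < \<phi> d"
    by (intro order_tendstoD(2)) (auto simp: zero_ereal_def)
  then have "\<forall>\<^sub>F n in sequentially. norm (x n - y n) < d"
  proof eventually_elim
    case (elim n)
    then have "\<not> \<phi> d \<le> \<phi> (norm (x n - y n))"
      using um[of n] by (metis leD order_trans)
    moreover have "\<phi> d \<le> \<phi> (norm (x n - y n))" if "d \<le> norm (x n - y n)"
      using assms(1) d that unfolding uniformly_monotone_with_def
      by (intro mono_onD[of "{0..}" \<phi>]) auto
    ultimately show ?case by linarith
  qed
  then show "\<exists>N. \<forall>n\<ge>N. norm (x n - y n - 0) < d"
    by (simp add: eventually_sequentially)
qed

theorem theorem4p2: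
  fixes A B :: "('a :: {real_inner, complete_space}) operator"
    and lam :: real
    and T T\<^sub>l :: "'a \<Rightarrow> 'a"
    and v :: 'a
    and Z :: "'a set"
  assumes "maximally_monotone A" and "maximally_monotone B"
    and "0 < lam" and "lam < 1"
    and T\<^sub>l: "T\<^sub>l = (\<lambda>x. (1 - lam) *\<^sub>R x + lam *\<^sub>R reflected_resolvent B (reflected_resolvent A x))"
    and T: "T = (\<lambda>x. (1/2) *\<^sub>R (x + reflected_resolvent B (reflected_resolvent A x)))"
    and v: "v = metric_projection (closure (range (\<lambda>x. x - T x))) 0"
    and Z: "Z = {x. 0 \<in> {- v} + A x + B (x - v)}"
    and "Z \<noteq> {}"
    and "\<exists>C \<in> {A, B}. \<exists>\<phi>. uniformly_monotone_with C \<phi> \<and> supercoercive \<phi>"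
  shows "\<exists>xbar. Z = {xbar} \<and>
    (\<forall>x. (\<lambda>n. resolvent A ((T\<^sub>l ^^ n) x)) \<longlonglongrightarrow> xbar \<and>
         (\<lambda>n. resolvent B (reflected_resolvent A ((T\<^sub>l ^^ n) x))) \<longlonglongrightarrow> xbar - v)"
proof -
  define a where "a = resolvent A"
  define b where "b = (\<lambda>x. resolvent B (reflected_resolvent A x))"
  define a' where "a' = (\<lambda>x. x - a x)"
  define b' where "b' = (\<lambda>x. a x - b x - a' x)"
  have a': "a' x \<in> A (a x)" for x
    unfolding a'_def a_def by (rule resolvent_mem) fact
  have RA: "reflected_resolvent A x = a x - a' x" for x
    by (simp add: reflected_resolvent_def a'_def a_def scaleR_2)
  have b': "b' x \<in> B (b x)" for x
    using resolvent_mem[OF \<open>maximally_monotone B\<close>, of "a x - a' x"]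
    by (simp add: b'_def b_def RA algebra_simps)
  have RBRA: "reflected_resolvent B (reflected_resolvent A x) = x - 2 *\<^sub>R (a x - b x)" for x
    unfolding reflected_resolvent_def[of B] by (simp add: b_def RA a'_def algebra_simps scaleR_2)
  have Tx: "T x = x - (a x - b x)" for x
    by (simp add: T RBRA algebra_simps scaleR_2 flip: scaleR_add_left)
  have Tlx: "T\<^sub>l x = x - (2 * lam) *\<^sub>R (a x - b x)" for x
    by (simp add: T\<^sub>l RBRA algebra_simps)
  have M: "x - T x = a x - b x" for x
    by (simp add: Tx)

  define K where "K x y = (T x - T y) \<bullet> ((a x - b x) - (a y - b y))" for x y
  define Ka where "Ka x y = (a x - a y) \<bullet> (a' x - a' y)" for x y
  define Kb where "Kb x y = (b x - b y) \<bullet> (b' x - b' y)" for x y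
  have K: "K x y = Ka x y + Kb x y" for x y
  proof -
    \<comment> \<open>Expand the product of the differences of \<open>a' + b\<close> and
      \<open>a - b\<close>: the cross terms are absorbed because
      \<open>b' = a - b - a'\<close>.\<close>
    have Ta: "T x = a' x + b x" for x by (simp add: Tx a'_def)
    show ?thesis
      unfolding K_def Ka_def Kb_def Ta b'_def
      by (simp add: inner_add_left inner_add_right inner_diff_left inner_diff_right inner_commute)
  qed
  have Ka: "0 \<le> Ka x y" and Kb: "0 \<le> Kb x y" for x y
    using maximally_monotone_mono[OF assms(1) a' a'] maximally_monotone_mono[OF assms(2) b' b']
    by (simp_all add: Ka_def Kb_def)
  have split: "(norm (x - y))\<^sup>2 = (norm (T x - T y))\<^sup>2 + (norm ((a x - b x) - (a y - b y)))\<^sup>2 + 2 * K x y" for x y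
  proof -
    have "x - y = (T x - T y) + ((a x - b x) - (a y - b y))" by (simp add: Tx)
    then show ?thesis
      unfolding K_def power2_norm_eq_inner
      by (simp only: inner_add_left inner_add_right) (simp add: inner_commute)
  qed
  have ne: "norm (T x - T y) \<le> norm (x - y)" for x y
    using split[of x y] K[of x y] Ka[of x y] Kb[of x y]
    by (intro power2_le_imp_le[OF _ norm_ge_zero]) (smt (verit) zero_le_power2)

  have vi: "0 \<le> v \<bullet> (a x - b x - v)" for x
  proof -
    have "a x - b x \<in> closure (range (\<lambda>x. x - T x))"
      unfolding M by (intro subsetD[OF closure_subset]) auto
    moreover have "closure (range (\<lambda>x. x - T x)) \<noteq> {}"
      by simp
    ultimately show ?thesis
      using metric_projection(2)[OF convex_closure_nonexpansive_displacement[OF ne] closed_closure, of _ 0]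
      unfolding v by fastforce
  qed
  \<comment> \<open>With \<open>z = y - t *\<^sub>R v\<close> and \<open>w\<close> its displacement,
    \<open>0 \<le> K y z\<close> bounds the squared norm of \<open>v - w\<close> by
    \<open>t * (v \<bullet> (v - w))\<close>, which is nonpositive by \<open>vi\<close>.\<close>
  have shift: "a (y - t *\<^sub>R v) - b (y - t *\<^sub>R v) = v" if y: "a y - b y = v" and "0 \<le> t" for y t
  proof -
    define z where "z = y - t *\<^sub>R v"
    define w where "w = a z - b z"
    have "T y - T z = t *\<^sub>R v - (v - w)"
      using y by (simp add: Tx w_def z_def algebra_simps)
    then have "K y z = t * (v \<bullet> (v - w)) - (v - w) \<bullet> (v - w)"
      by (simp add: K_def y w_def[symmetric] inner_diff_left)
    moreover have "0 \<le> K y z"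
      using K Ka Kb by simp
    moreover have "t * (v \<bullet> (v - w)) \<le> 0"
      using vi[of z] \<open>0 \<le> t\<close> unfolding w_def[symmetric]
      by (simp add: mult_nonneg_nonpos inner_diff_right)
    ultimately have "(v - w) \<bullet> (v - w) \<le> 0" by linarith
    then have "v - w = 0" by (meson inner_eq_zero_iff inner_ge_zero order_antisym)
    then show ?thesis by (simp add: w_def z_def)
  qed

  \<comment> \<open>\<open>Ka\<close> and \<open>Kb\<close> are squeezed between 0 and
    \<open>K\<close>. If \<open>B\<close> is the uniformly monotone operator, the
    \<open>b\<close>-differences vanish first, and \<open>M0\<close> transfers this to
    \<open>a\<close>.\<close>
  have conv: "(\<lambda>n. a (x n) - a (y n)) \<longlonglongrightarrow> 0"
    if M0: "(\<lambda>n. (a (x n) - b (x n)) - (a (y n) - b (y n))) \<longlonglongrightarrow> 0" and K0: "(\<lambda>n. K (x n) (y n)) \<longlonglongrightarrow> 0"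
    for x y
  proof -
    have "(\<lambda>n. Ka (x n) (y n)) \<longlonglongrightarrow> 0" "(\<lambda>n. Kb (x n) (y n)) \<longlonglongrightarrow> 0"
      using real_tendsto_sandwich[OF _ _ tendsto_const K0]
      by (simp_all add: K Ka Kb)
    note lims = this[unfolded Ka_def Kb_def]
    consider \<phi> where "uniformly_monotone_with A \<phi>" | \<phi> where "uniformly_monotone_with B \<phi>"
      using assms(10) by blast
    then show ?thesis
    proof cases
      case 1
      show ?thesis
        by (rule uniformly_monotone_with_tendsto[OF 1 a' a' lims(1)])
    next
      case 2
      have "(\<lambda>n. b (x n) - b (y n)) \<longlonglongrightarrow> 0"
        by (rule uniformly_monotone_with_tendsto[OF 2 b' b' lims(2)])
      from tendsto_add[OF M0 this] show ?thesis
        by simp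
    qed
  qed
  \<comment> \<open>Apply \<open>conv\<close> to constant sequences: equal displacements make
    \<open>K y z\<close> zero.\<close>
  have const: "a y = a z" if "a y - b y = v" "a z - b z = v" for y z
  proof -
    have "(\<lambda>n::nat. a y - a z) \<longlonglongrightarrow> 0"
      using that by (intro conv) (simp_all add: K_def)
    then show ?thesis
      by (simp add: LIMSEQ_const_iff)
  qed
  have Z_shadow: "\<exists>y. a y = x \<and> b y = x - v" if "x \<in> Z" for x
  proof -
    have "\<exists>p\<in>A x. \<exists>q\<in>B (x - v). 0 = - v + p + q"
      using that unfolding Z set_plus_def by blast
    then obtain p q where pq: "p \<in> A x" "q \<in> B (x - v)" and "0 = - v + p + q"
      by blast
    then have v_eq: "v = p + q"
      by (simp add: algebra_simps)
    \<comment> \<open>The preimage is \<open>x + p\<close>: there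
      \<open>reflected_resolvent A\<close> takes the value \<open>x - p\<close>, which exceeds
      \<open>x - v\<close> by exactly \<open>q\<close>.\<close>
    have ax: "a (x + p) = x"
      unfolding a_def using pq by (intro resolvent_eqI assms) simp
    have "x - p - (x - v) = q"
      by (simp add: v_eq)
    then have "b (x + p) = x - v"
      unfolding b_def RA a'_def ax using pq by (intro resolvent_eqI assms) simp
    with ax show ?thesis by blast
  qed
  obtain xbar where "xbar \<in> Z" using \<open>Z \<noteq> {}\<close> by blast
  then obtain y where y: "a y = xbar" "b y = xbar - v"
    using Z_shadow by blast
  have "Z = {xbar}"
  proof -
    have "z = xbar" if "z \<in> Z" for z
      using Z_shadow[OF that] const y by fastforce
    then show ?thesis using \<open>xbar \<in> Z\<close> by blast
  qed
  moreover have "(\<lambda>n. a ((T\<^sub>l ^^ n) x)) \<longlonglongrightarrow> xbar" "(\<lambda>n. b ((T\<^sub>l ^^ n) x)) \<longlonglongrightarrow> xbar - v" for x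
  proof -
    define X where "X n = (T\<^sub>l ^^ n) x" for n
    define Y where "Y n = y - (n * (2 * lam)) *\<^sub>R v" for n :: nat
    have MY: "a (Y n) - b (Y n) = v" for n
      unfolding Y_def using y \<open>0 < lam\<close> by (intro shift) auto
    have aY: "a (Y n) = xbar" for n
      using const[OF MY, of y] y by simp
    define D where "D n = (a (X n) - b (X n)) - v" for n
    define g where "g n = (norm (X n - Y n))\<^sup>2" for n
    have step: "X (Suc n) - Y (Suc n) = (X n - Y n) - (2 * lam) *\<^sub>R D n" for n
      by (simp add: X_def Y_def D_def Tlx algebra_simps)
    \<comment> \<open>Expanding the square in \<open>step\<close> gives \<open>4 * lam\<close> times
      \<open>(X n - Y n) \<bullet> D n\<close>, which contains a full
      \<open>(norm (D n))\<^sup>2\<close>, minus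
      \<open>4 * lam\<^sup>2 * (norm (D n))\<^sup>2\<close>; hence the factor
      \<open>1 - lam\<close>.\<close>
    have decr: "g n - g (Suc n) = 4 * lam * (1 - lam) * (norm (D n))\<^sup>2 + 4 * lam * K (X n) (Y n)" for n
    proof -
      have "X n - Y n = (T (X n) - T (Y n)) + D n"
        by (simp add: Tx D_def MY)
      then have "(X n - Y n) \<bullet> D n = K (X n) (Y n) + (norm (D n))\<^sup>2"
        by (simp add: K_def MY D_def inner_add_left power2_norm_eq_inner)
      then show ?thesis
        unfolding g_def step power2_norm_eq_inner
        by (simp add: inner_diff_left inner_diff_right inner_commute algebra_simps)
    qed
    have t1: "0 \<le> 4 * lam * (1 - lam) * (norm (D n))\<^sup>2" and t2: "0 \<le> 4 * lam * K (X n) (Y n)" for n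
      using \<open>0 < lam\<close> \<open>lam < 1\<close> Ka Kb by (simp_all add: K)
    have "decseq g"
      using decr t1 t2 by (intro decseq_SucI) (smt (verit))
    then obtain L where "g \<longlonglongrightarrow> L"
      using decseq_convergent[of g 0] by (auto simp: g_def)
    then have "(\<lambda>n. g n - g (Suc n)) \<longlonglongrightarrow> L - L"
      by (intro tendsto_diff LIMSEQ_Suc)
    then have lim0: "(\<lambda>n. g n - g (Suc n)) \<longlonglongrightarrow> 0" by simp
    \<comment> \<open>Both summands of the decrement are nonnegative, so each is squeezed to 0 with
      it.\<close>
    have "(\<lambda>n. 4 * lam * (1 - lam) * (norm (D n))\<^sup>2) \<longlonglongrightarrow> 0" "(\<lambda>n. 4 * lam * K (X n) (Y n)) \<longlonglongrightarrow> 0"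
      using real_tendsto_sandwich[OF _ _ tendsto_const lim0] t1 t2
      by (simp_all add: decr)
    from tendsto_mult_left[OF this(1), of "inverse (4 * lam * (1 - lam))"]
      tendsto_mult_left[OF this(2), of "inverse (4 * lam)"]
    have "(\<lambda>n. (norm (D n))\<^sup>2) \<longlonglongrightarrow> 0" and K0: "(\<lambda>n. K (X n) (Y n)) \<longlonglongrightarrow> 0"
      using \<open>0 < lam\<close> \<open>lam < 1\<close> by (simp_all add: mult.assoc)
    from tendsto_real_sqrt[OF this(1)] have D0: "D \<longlonglongrightarrow> 0"
      by (simp add: tendsto_norm_zero_iff)
    have "(\<lambda>n. a (X n) - a (Y n)) \<longlonglongrightarrow> 0"
      using D0 K0 by (intro conv) (simp_all add: D_def[abs_def] MY)
    then have aX: "(\<lambda>n. a (X n)) \<longlonglongrightarrow> xbar"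
      by (simp add: aY LIM_zero_iff)
    \<comment> \<open>By the definition of \<open>D\<close>, this sequence is
      \<open>b (X n)\<close>.\<close>
    moreover have "(\<lambda>n. a (X n) - D n - v) \<longlonglongrightarrow> xbar - 0 - v"
      by (intro tendsto_intros aX D0)
    ultimately show "(\<lambda>n. a ((T\<^sub>l ^^ n) x)) \<longlonglongrightarrow> xbar" "(\<lambda>n. b ((T\<^sub>l ^^ n) x)) \<longlonglongrightarrow> xbar - v"
      by (simp_all add: D_def X_def)
  qed
  ultimately show ?thesis
    unfolding a_def b_def by blast
qed

end
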